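(* Let $\tau$ be a definable ring topology on an NIP field $(K,+,\cdot,\ldots)$, possibly with extra structure. Then $\tau$ is locally bounded.
   Context: A ring topology on a field $K$ is a Hausdorff, non-discrete topology on $K$ for which $+,-,\cdot$ are continuous. $(K,+,\cdot,\ldots)$ is a first-order structure expanding a field whose complete theory is NIP. "Definable" means definable with parameters. A topology on a definable set is definable if some uniformly definable family of sets is a basis of open sets. A set $B \subseteq K$ is bounded (with respect to $\tau$) if for every neighborhood $U$ of $0$ there is some $c \in K^\times$ with $cB \subseteq U$. The topology $\tau$ is locally bounded if some neighborhood of $0$ is bounded. *)

theory Defs
  imports "HOL-Analysis.Analysis"
begin

section \<open>First-order logic\<close>

record ('f, 'r) lang =
  fun_arity :: "'f \<Rightarrow> nat"
  rel_arity :: "'r \<Rightarrow> nat"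

datatype 'f tm = Var nat | Fn 'f "'f tm list"

datatype ('f, 'r) fm =
    Equal "'f tm" "'f tm"
  | Pred 'r "'f tm list"
  | Neg "('f, 'r) fm"
  | Conj "('f, 'r) fm" "('f, 'r) fm"
  | Ex nat "('f, 'r) fm"

primrec wf_tm :: "('f, 'r) lang \<Rightarrow> 'f tm \<Rightarrow> bool" where
  "wf_tm L (Var i) \<longleftrightarrow> True"
| "wf_tm L (Fn f ts) \<longleftrightarrow> length ts = fun_arity L f \<and> list_all (wf_tm L) ts"

primrec wf_fm :: "('f, 'r) lang \<Rightarrow> ('f, 'r) fm \<Rightarrow> bool" where
  "wf_fm L (Equal s t) \<longleftrightarrow> wf_tm L s \<and> wf_tm L t"
| "wf_fm L (Pred r ts) \<longleftrightarrow> length ts = rel_arity L r \<and> list_all (wf_tm L) ts"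
| "wf_fm L (Neg p) \<longleftrightarrow> wf_fm L p"
| "wf_fm L (Conj p q) \<longleftrightarrow> wf_fm L p \<and> wf_fm L q"
| "wf_fm L (Ex i p) \<longleftrightarrow> wf_fm L p"

primrec fv_tm :: "'f tm \<Rightarrow> nat set" where
  "fv_tm (Var i) = {i}"
| "fv_tm (Fn f ts) = \<Union>(set (map fv_tm ts))"

primrec fv_fm :: "('f, 'r) fm \<Rightarrow> nat set" where
  "fv_fm (Equal s t) = fv_tm s \<union> fv_tm t"
| "fv_fm (Pred r ts) = (\<Union>t \<in> set ts. fv_tm t)"
| "fv_fm (Neg p) = fv_fm p"
| "fv_fm (Conj p q) = fv_fm p \<union> fv_fm q"
| "fv_fm (Ex i p) = fv_fm p - {i}"

text \<open>
  The universe of a structure is the whole type \<open>'a\<close>. The value of an interpretation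
  on a list whose length differs from the arity is irrelevant, since well-formed formulas
  never refer to it.
\<close>

record ('f, 'r, 'a) fo_struct =
  fun_interp :: "'f \<Rightarrow> 'a list \<Rightarrow> 'a"
  rel_interp :: "'r \<Rightarrow> 'a list \<Rightarrow> bool"

primrec eval_tm :: "('f, 'r, 'a) fo_struct \<Rightarrow> (nat \<Rightarrow> 'a) \<Rightarrow> 'f tm \<Rightarrow> 'a" where
  "eval_tm M e (Var i) = e i"
| "eval_tm M e (Fn f ts) = fun_interp M f (map (eval_tm M e) ts)"

primrec sat :: "('f, 'r, 'a) fo_struct \<Rightarrow> (nat \<Rightarrow> 'a) \<Rightarrow> ('f, 'r) fm \<Rightarrow> bool" where
  "sat M e (Equal s t) \<longleftrightarrow> eval_tm M e s = eval_tm M e t"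
| "sat M e (Pred r ts) \<longleftrightarrow> rel_interp M r (map (eval_tm M e) ts)"
| "sat M e (Neg p) \<longleftrightarrow> \<not> sat M e p"
| "sat M e (Conj p q) \<longleftrightarrow> sat M e p \<and> sat M e q"
| "sat M e (Ex i p) \<longleftrightarrow> (\<exists>x. sat M (e(i := x)) p)"

text \<open>
  A tuple \<open>xs\<close> is substituted for the variables \<open>0, \<dots>, length xs - 1\<close>. This is only used
  for formulas all of whose free variables lie in that range.
\<close>

definition holds :: "('f, 'r, 'a) fo_struct \<Rightarrow> ('f, 'r) fm \<Rightarrow> 'a list \<Rightarrow> bool" where
  "holds M p xs \<longleftrightarrow> sat M (\<lambda>i. xs ! i) p"

definition complete_theory :: "('f, 'r) lang \<Rightarrow> ('f, 'r, 'a) fo_struct \<Rightarrow> ('f, 'r) fm set" where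
  "complete_theory L M = {p. wf_fm L p \<and> fv_fm p = {} \<and> (\<forall>e. sat M e p)}"

definition is_model :: "('f, 'r, 'a) fo_struct \<Rightarrow> ('f, 'r) fm set \<Rightarrow> bool" where
  "is_model N T \<longleftrightarrow> (\<forall>p \<in> T. \<forall>e. sat N e p)"

section \<open>NIP\<close>

text \<open>
  The independence property in \<open>N\<close> of the partitioned formula \<open>p(x; y)\<close>, where
  \<open>x\<close> stands for the variables \<open>0, \<dots>, k - 1\<close> and \<open>y\<close> for \<open>k, \<dots>, k + l - 1\<close>.
\<close>

definition has_IP :: "('f, 'r, 'a) fo_struct \<Rightarrow> ('f, 'r) fm \<Rightarrow> nat \<Rightarrow> nat \<Rightarrow> bool" where
  "has_IP N p k l \<longleftrightarrow>
    (\<forall>n. \<exists>a :: nat \<Rightarrow> 'a list.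
       (\<forall>i<n. length (a i) = k) \<and>
       (\<forall>S \<subseteq> {..<n}. \<exists>b. length b = l \<and> (\<forall>i<n. holds N p (a i @ b) \<longleftrightarrow> i \<in> S)))"

text \<open>
  HOL cannot quantify over models of all types, so the type of the models is a parameter.
  For the complete theory of a structure with universe \<open>'a\<close> it is enough to consider
  models with universe \<open>'a\<close>: for each \<open>n\<close>, the existence of \<open>a\<close> in \<open>has_IP\<close>
  is expressed by a first-order sentence, so all models agree on it.
\<close>

definition NIP_theory :: "'a itself \<Rightarrow> ('f, 'r) lang \<Rightarrow> ('f, 'r) fm set \<Rightarrow> bool" where
  "NIP_theory _ L T \<longleftrightarrow>
    (\<forall>N :: ('f, 'r, 'a) fo_struct. is_model N T \<longrightarrow>
       (\<forall>p k l. wf_fm L p \<and> fv_fm p \<subseteq> {..<k + l} \<longrightarrow> \<not> has_IP N p k l))"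

section \<open>Definability with parameters\<close>

text \<open>Subsets of \<open>K\<^sup>k\<close> are represented as sets of lists of length \<open>k\<close>; \<open>c\<close> are the parameters.\<close>

definition definable ::
  "('f, 'r) lang \<Rightarrow> ('f, 'r, 'a) fo_struct \<Rightarrow> nat \<Rightarrow> 'a list set \<Rightarrow> bool" where
  "definable L M k X \<longleftrightarrow>
    (\<exists>p c. wf_fm L p \<and> fv_fm p \<subseteq> {..<k + length c} \<and>
           X = {xs. length xs = k \<and> holds M p (xs @ c)})"

definition uniformly_definable_family ::
  "('f, 'r) lang \<Rightarrow> ('f, 'r, 'a) fo_struct \<Rightarrow> 'a set set \<Rightarrow> bool" where
  "uniformly_definable_family L M \<B> \<longleftrightarrow>
    (\<exists>m Y Z. definable L M m Y \<and> definable L M (Suc m) Z \<and>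
             \<B> = (\<lambda>b. {x. x # b \<in> Z}) ` Y)"

text \<open>The second conjunct says that \<open>\<B>\<close> is a basis of open sets.\<close>

definition definable_topology ::
  "('f, 'r) lang \<Rightarrow> ('f, 'r, 'a) fo_struct \<Rightarrow> 'a topology \<Rightarrow> bool" where
  "definable_topology L M \<tau> \<longleftrightarrow>
    (\<exists>\<B>. uniformly_definable_family L M \<B> \<and> openin \<tau> = arbitrary union_of (\<lambda>B. B \<in> \<B>))"

section \<open>Structures expanding a field, and ring topologies\<close>

text \<open>
  Only symbols for addition and multiplication are required; zero, one, negation and
  inversion are definable from them.
\<close>

definition expands_field :: "('f, 'r) lang \<Rightarrow> ('f, 'r, 'a::field) fo_struct \<Rightarrow> bool" where
  "expands_field L M \<longleftrightarrow>
    (\<exists>add mul. fun_arity L add = 2 \<and> (\<forall>x y. fun_interp M add [x, y] = x + y) \<and>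
               fun_arity L mul = 2 \<and> (\<forall>x y. fun_interp M mul [x, y] = x * y))"

definition ring_topology :: "'a::field topology \<Rightarrow> bool" where
  "ring_topology \<tau> \<longleftrightarrow>
    topspace \<tau> = UNIV \<and> Hausdorff_space \<tau> \<and> \<tau> \<noteq> discrete_topology UNIV \<and>
    continuous_map (prod_topology \<tau> \<tau>) \<tau> (\<lambda>(x, y). x + y) \<and>
    continuous_map (prod_topology \<tau> \<tau>) \<tau> (\<lambda>(x, y). x - y) \<and>
    continuous_map (prod_topology \<tau> \<tau>) \<tau> (\<lambda>(x, y). x * y)"

definition nbhd_of :: "'a topology \<Rightarrow> 'a \<Rightarrow> 'a set \<Rightarrow> bool" where
  "nbhd_of \<tau> x U \<longleftrightarrow> U \<subseteq> topspace \<tau> \<and> (\<exists>V. openin \<tau> V \<and> x \<in> V \<and> V \<subseteq> U)"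

definition bounded_wrt :: "'a::field topology \<Rightarrow> 'a set \<Rightarrow> bool" where
  "bounded_wrt \<tau> B \<longleftrightarrow> (\<forall>U. nbhd_of \<tau> 0 U \<longrightarrow> (\<exists>c. c \<noteq> 0 \<and> (\<lambda>x. c * x) ` B \<subseteq> U))"

definition locally_bounded :: "'a::field topology \<Rightarrow> bool" where
  "locally_bounded \<tau> \<longleftrightarrow> (\<exists>U. nbhd_of \<tau> 0 U \<and> bounded_wrt \<tau> U)"

end

theory Submission
  imports Defs
begin

text \<open>
  Call an open set containing \<open>0\<close> a zero neighbourhood. The proof compares a zero
  neighbourhood \<open>U\<close> with finite intersections \<open>e\<^sub>1 U \<inter> \<dots> \<inter> e\<^sub>r U\<close> of its nonzero scalings.

  Suppose first that, for some \<open>U\<close>, every zero neighbourhood \<open>V\<close> contains such an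
  intersection, where the number of scalings may depend on \<open>V\<close>. Choose a zero neighbourhood
  \<open>U'\<close> with \<open>U' U' \<subseteq> U\<close>. As the topology is not discrete, some \<open>c \<noteq> 0\<close> lies in
  \<open>e\<^sub>1 U' \<inter> \<dots> \<inter> e\<^sub>r U'\<close>, and then \<open>c U' \<subseteq> e\<^sub>1 U \<inter> \<dots> \<inter> e\<^sub>r U \<subseteq> V\<close>. So a single scaling of
  \<open>U'\<close> suffices and \<open>U'\<close> is bounded (\<open>locally_bounded_if_scalings_subbase\<close>).

  Suppose now that no such \<open>U\<close> exists. Then NIP fails, by an approximate version of the
  Baldwin-Saxl argument. For subgroups, that argument takes groups \<open>H\<^sub>1, \<dots>, H\<^sub>n\<close> none of which
  contains the intersection of the others, picks \<open>a\<^sub>i\<close> outside \<open>H\<^sub>i\<close> but in all other \<open>H\<^sub>j\<close>,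
  and observes that the subset sums of the \<open>a\<^sub>i\<close> lie in every possible combination of the
  \<open>H\<^sub>i\<close>. Here the role of \<open>H\<^sub>i\<close> is played by a scaling of a basic open set \<open>W\<^sub>i\<close>, and the lack of
  closure under addition is absorbed by a margin: \<open>a\<^sub>j\<close> lies in a scaling of some much smaller
  \<open>V\<^sub>i\<close> for \<open>j \<noteq> i\<close>, where sums of at most \<open>n\<close> elements of \<open>V\<^sub>i\<close> stay in \<open>W\<^sub>i\<close>, while \<open>a\<^sub>i\<close> avoids the
  scaling of the larger set \<open>W\<^sub>i - W\<^sub>i\<close> (\<open>subset_sums_shatter\<close>). The failing hypothesis
  provides arbitrarily long independent systems of this kind (\<open>independent_system_exists\<close>),
  and the scalings of a uniformly definable family form a uniformly definable family, so NIP
  bounds their length (\<open>NIP_bounds_shattered_scalings\<close>).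
\<close>

section \<open>Zero neighbourhoods of a ring topology\<close>

locale ring_top =
  fixes \<tau> :: "'a::field topology"
  assumes ring_topology: "ring_topology \<tau>"
begin

definition zero_nbhd :: "'a set \<Rightarrow> bool" where
  "zero_nbhd U \<longleftrightarrow> openin \<tau> U \<and> 0 \<in> U"

lemma topspace_UNIV: "topspace \<tau> = UNIV"
  using ring_topology unfolding ring_topology_def by blast

lemma zero_nbhd_UNIV: "zero_nbhd UNIV"
  unfolding zero_nbhd_def using openin_topspace[of \<tau>] by (simp add: topspace_UNIV)

lemma zero_nbhd_Int: "zero_nbhd U \<Longrightarrow> zero_nbhd V \<Longrightarrow> zero_nbhd (U \<inter> V)"
  unfolding zero_nbhd_def by auto

lemma zero_nbhd_INT:
  assumes "finite I" "\<And>i. i \<in> I \<Longrightarrow> zero_nbhd (U i)"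
  shows "zero_nbhd {x. \<forall>i\<in>I. x \<in> U i}"
  using assms
proof (induction I rule: finite_induct)
  case empty
  then show ?case by (simp add: zero_nbhd_UNIV)
next
  case (insert i I)
  have "{x. \<forall>j\<in>insert i I. x \<in> U j} = U i \<inter> {x. \<forall>j\<in>I. x \<in> U j}" by auto
  then show ?case using insert zero_nbhd_Int by auto
qed

lemma nbhd_of_zero_iff: "nbhd_of \<tau> 0 U \<longleftrightarrow> (\<exists>V. zero_nbhd V \<and> V \<subseteq> U)"
  unfolding nbhd_of_def zero_nbhd_def topspace_UNIV by auto

lemma zero_nbhd_op:
  assumes "continuous_map (prod_topology \<tau> \<tau>) \<tau> (\<lambda>(x, y). op x y)"
    and "op 0 0 = 0" and "zero_nbhd U"
  shows "\<exists>V. zero_nbhd V \<and> (\<forall>x\<in>V. \<forall>y\<in>V. op x y \<in> U)"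
proof -
  let ?P = "{z. (\<lambda>(x, y). op x y) z \<in> U}"
  have P: "openin (prod_topology \<tau> \<tau>) ?P"
    using assms(1,3) unfolding continuous_map_def zero_nbhd_def
    by (simp add: topspace_UNIV)
  have "(0, 0) \<in> ?P"
    using assms(2,3) by (simp add: zero_nbhd_def)
  then have "\<exists>A B. openin \<tau> A \<and> openin \<tau> B \<and> 0 \<in> A \<and> 0 \<in> B \<and> A \<times> B \<subseteq> ?P"
    by (rule P[unfolded openin_prod_topology_alt, rule_format])
  then obtain A B where AB: "openin \<tau> A" "openin \<tau> B" "0 \<in> A" "0 \<in> B" "A \<times> B \<subseteq> ?P"
    by (elim exE conjE)
  have "zero_nbhd (A \<inter> B)" using AB unfolding zero_nbhd_def by auto
  moreover have "op x y \<in> U" if "x \<in> A \<inter> B" "y \<in> A \<inter> B" for x y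
    using subsetD[OF AB(5), of "(x, y)"] that by simp
  ultimately show ?thesis by blast
qed

lemma zero_nbhd_add: "zero_nbhd U \<Longrightarrow> \<exists>V. zero_nbhd V \<and> (\<forall>x\<in>V. \<forall>y\<in>V. x + y \<in> U)"
  using zero_nbhd_op[of "(+)"] ring_topology unfolding ring_topology_def by simp

lemma zero_nbhd_diff: "zero_nbhd U \<Longrightarrow> \<exists>V. zero_nbhd V \<and> (\<forall>x\<in>V. \<forall>y\<in>V. x - y \<in> U)"
  using zero_nbhd_op[of "(-)"] ring_topology unfolding ring_topology_def by simp

lemma zero_nbhd_mult: "zero_nbhd U \<Longrightarrow> \<exists>V. zero_nbhd V \<and> (\<forall>x\<in>V. \<forall>y\<in>V. x * y \<in> U)"
  using zero_nbhd_op[of "(*)"] ring_topology unfolding ring_topology_def by simp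

lemma zero_nbhd_sum:
  assumes "finite I" and "zero_nbhd W"
  shows "\<exists>V. zero_nbhd V \<and> (\<forall>S f. S \<subseteq> I \<longrightarrow> (\<forall>j\<in>S. f j \<in> V) \<longrightarrow> sum f S \<in> W)"
  using assms
proof (induction I arbitrary: W rule: finite_induct)
  case empty
  then show ?case by (auto simp: zero_nbhd_def)
next
  case (insert i I)
  obtain A where A: "zero_nbhd A" "\<And>x y. x \<in> A \<Longrightarrow> y \<in> A \<Longrightarrow> x + y \<in> W"
    using zero_nbhd_add[OF insert.prems] by blast
  obtain B where B: "zero_nbhd B"
    "\<And>S f. S \<subseteq> I \<Longrightarrow> (\<forall>j\<in>S. f j \<in> B) \<Longrightarrow> sum f S \<in> A"
    using insert.IH[OF A(1)] by blast
  have "sum f S \<in> W" if S: "S \<subseteq> insert i I" "\<forall>j\<in>S. f j \<in> A \<inter> B" for S f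
  proof -
    have fin: "finite S" using S(1) insert.hyps(1) finite_subset by auto
    have rest: "sum f (S - {i}) \<in> A" using B(2)[of "S - {i}" f] S by auto
    have "0 \<in> A" using A(1) by (simp add: zero_nbhd_def)
    show ?thesis
    proof (cases "i \<in> S")
      case True
      then show ?thesis using A(2) rest S(2) sum.remove[OF fin True, of f] by auto
    next
      case False
      then show ?thesis using A(2)[OF \<open>0 \<in> A\<close> rest] by simp
    qed
  qed
  then show ?case using zero_nbhd_Int[OF A(1) B(1)] by blast
qed

lemma openin_preimage_mult:
  assumes "openin \<tau> U"
  shows "openin \<tau> {x. c * x \<in> U}"
proof -
  have "continuous_map \<tau> \<tau> ((\<lambda>(x, y). x * y) \<circ> (\<lambda>x. (c, x)))"
    by (rule continuous_map_compose[of _ "prod_topology \<tau> \<tau>"])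
       (use ring_topology in \<open>auto simp: ring_topology_def continuous_map_pairedI\<close>)
  then show ?thesis using assms unfolding continuous_map_def by (simp add: topspace_UNIV)
qed

lemma openin_preimage_diff:
  assumes "openin \<tau> U"
  shows "openin \<tau> {x. x - c \<in> U}"
proof -
  have "continuous_map \<tau> \<tau> ((\<lambda>(x, y). x - y) \<circ> (\<lambda>x. (x, c)))"
    by (rule continuous_map_compose[of _ "prod_topology \<tau> \<tau>"])
       (use ring_topology in \<open>auto simp: ring_topology_def continuous_map_pairedI\<close>)
  then show ?thesis using assms unfolding continuous_map_def by (simp add: topspace_UNIV)
qed

lemma zero_nbhd_preimage_mult: "zero_nbhd U \<Longrightarrow> zero_nbhd {x. c * x \<in> U}"
  unfolding zero_nbhd_def using openin_preimage_mult by simp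

text \<open>If \<open>{0}\<close> were open, then so would be its translates, and the topology would be discrete.\<close>

lemma zero_nbhd_nontrivial:
  assumes "zero_nbhd U"
  shows "\<exists>x\<in>U. x \<noteq> 0"
proof (rule ccontr)
  assume "\<not> ?thesis"
  then have "U = {0}" using assms by (auto simp: zero_nbhd_def)
  then have "openin \<tau> {0}" using assms by (simp add: zero_nbhd_def)
  then have "openin \<tau> {x}" for x using openin_preimage_diff[of "{0}" x] by simp
  then have "discrete_topology UNIV = \<tau>"
    unfolding discrete_topology_unique by (simp add: topspace_UNIV)
  then show False using ring_topology unfolding ring_topology_def by blast
qed

section \<open>Finite intersections of scalings\<close>

text \<open>
  With \<open>V V \<subseteq> U\<close>, every \<open>c\<close> in an intersection of scalings of \<open>V\<close> carries all of \<open>V\<close> into the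
  same intersection of scalings of \<open>U\<close>. This trades the finitely many scalars for one. The
  scalings are written as preimages under multiplication by \<open>e\<close>, so \<open>e\<close> stands for the inverse
  of the scaling factor; \<open>e = 0\<close> gives the void condition.
\<close>

lemma locally_bounded_if_scalings_subbase:
  assumes "zero_nbhd U"
    and "\<And>V. zero_nbhd V \<Longrightarrow> \<exists>E. finite E \<and> {x. \<forall>e\<in>E. e * x \<in> U} \<subseteq> V"
  shows "locally_bounded \<tau>"
proof -
  obtain V where V: "zero_nbhd V" "\<And>x y. x \<in> V \<Longrightarrow> y \<in> V \<Longrightarrow> x * y \<in> U"
    using zero_nbhd_mult[OF assms(1)] by blast
  have "bounded_wrt \<tau> V"
    unfolding bounded_wrt_def
  proof (intro allI impI)
    fix T assume "nbhd_of \<tau> 0 T"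
    then obtain T' where T': "zero_nbhd T'" "T' \<subseteq> T" unfolding nbhd_of_zero_iff by blast
    obtain E where E: "finite E" "{x. \<forall>e\<in>E. e * x \<in> U} \<subseteq> T'"
      using assms(2)[OF T'(1)] by blast
    have "zero_nbhd {x. \<forall>e\<in>E. x \<in> {x. e * x \<in> V}}"
      by (rule zero_nbhd_INT[OF E(1)]) (rule zero_nbhd_preimage_mult[OF V(1)])
    then obtain c where c: "c \<noteq> 0" "\<And>e. e \<in> E \<Longrightarrow> e * c \<in> V"
      using zero_nbhd_nontrivial by blast
    have "c * x \<in> T" if "x \<in> V" for x
    proof -
      have "e * (c * x) \<in> U" if "e \<in> E" for e
        using V(2)[OF c(2)[OF that] \<open>x \<in> V\<close>] by (simp add: mult.assoc)
      then show ?thesis using E(2) T'(2) by blast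
    qed
    then show "\<exists>c. c \<noteq> 0 \<and> (\<lambda>x. c * x) ` V \<subseteq> T" using c(1) by blast
  qed
  moreover have "nbhd_of \<tau> 0 V" unfolding nbhd_of_zero_iff using V(1) by blast
  ultimately show ?thesis unfolding locally_bounded_def by blast
qed

section \<open>Independent systems of scalings\<close>

text \<open>
  The point \<open>a i\<close> witnesses that the \<open>i\<close>-th scaling does not contain the intersection of the
  others. The gap between \<open>V i\<close> and \<open>W i - W i\<close> is the margin that replaces closure
  under addition; \<open>n\<close> bounds the number of summands, and is kept apart from the length \<open>k\<close> so
  that systems can be extended one member at a time.
\<close>

definition independent_system ::
  "nat \<Rightarrow> 'a set set \<Rightarrow> nat \<Rightarrow> (nat \<Rightarrow> 'a set) \<Rightarrow> (nat \<Rightarrow> 'a set) \<Rightarrow> (nat \<Rightarrow> 'a) \<Rightarrow> (nat \<Rightarrow> 'a) \<Rightarrow> bool"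
  where
  "independent_system n \<B> k W V d a \<longleftrightarrow>
    (\<forall>i<k. W i \<in> \<B> \<and> zero_nbhd (V i) \<and>
       (\<forall>S f. S \<subseteq> {..<n} \<longrightarrow> (\<forall>j\<in>S. f j \<in> V i) \<longrightarrow> sum f S \<in> W i) \<and>
       (\<forall>x\<in>W i. \<forall>y\<in>W i. d i * a i \<noteq> x - y) \<and>
       (\<forall>j<k. j \<noteq> i \<longrightarrow> d i * a j \<in> V i))"

lemma independent_systemD:
  assumes "independent_system n \<B> k W V d a" and "i < k"
  shows "W i \<in> \<B>"
    and "zero_nbhd (V i)"
    and "\<And>S f. S \<subseteq> {..<n} \<Longrightarrow> (\<And>j. j \<in> S \<Longrightarrow> f j \<in> V i) \<Longrightarrow> sum f S \<in> W i"
    and "\<And>x y. x \<in> W i \<Longrightarrow> y \<in> W i \<Longrightarrow> d i * a i \<noteq> x - y"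
    and "\<And>j. j < k \<Longrightarrow> j \<noteq> i \<Longrightarrow> d i * a j \<in> V i"
  using assms(1)[unfolded independent_system_def, THEN spec, THEN mp, OF assms(2)]
  by simp_all

text \<open>
  If \<open>i \<in> T\<close>, the sum over the complement of \<open>T\<close> involves only terms that the \<open>i\<close>-th factor
  \<open>d i\<close> carries into \<open>V i\<close>. Otherwise it differs from \<open>a i\<close> by such a sum, so it cannot be
  carried into \<open>W i\<close> without putting \<open>d i * a i\<close> into \<open>W i - W i\<close>.
\<close>

lemma subset_sums_shatter:
  assumes "independent_system n \<B> n W V d a" and "i < n"
  shows "d i * (\<Sum>j\<in>{..<n} - T. a j) \<in> W i \<longleftrightarrow> i \<in> T"
proof -
  let ?R = "\<lambda>S. \<Sum>j\<in>S. d i * a j"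
  have small: "?R S \<in> W i" if "S \<subseteq> {..<n} - {i}" for S
    by (rule independent_systemD(3)[OF assms])
       (use that in \<open>auto intro!: independent_systemD(5)[OF assms]\<close>)
  have eq: "d i * (\<Sum>j\<in>{..<n} - T. a j) = ?R ({..<n} - T)"
    by (simp add: sum_distrib_left)
  show ?thesis
  proof
    assume "i \<in> T"
    then show "d i * (\<Sum>j\<in>{..<n} - T. a j) \<in> W i"
      unfolding eq by (intro small) auto
  next
    assume mem: "d i * (\<Sum>j\<in>{..<n} - T. a j) \<in> W i"
    show "i \<in> T"
    proof (rule ccontr)
      assume "i \<notin> T"
      then have "?R ({..<n} - T) = d i * a i + ?R ({..<n} - T - {i})"
        using assms(2) by (intro sum.remove) auto
      then have "d i * a i = ?R ({..<n} - T) - ?R ({..<n} - T - {i})" by simp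
      moreover have "?R ({..<n} - T - {i}) \<in> W i" by (intro small) auto
      ultimately show False
        using independent_systemD(4)[OF assms] mem unfolding eq by blast
    qed
  qed
qed

text \<open>
  The order of choices matters. The new neighbourhood \<open>U\<close> contains no finite intersection of
  scalings of \<open>Q\<close>, the intersection of the old \<open>V i\<close>. Next come \<open>W k\<close> and \<open>V k\<close>, then a factor \<open>d k\<close> so close to \<open>0\<close>
  that it carries all old points into \<open>V k\<close>, which keeps them valid. The property of \<open>U\<close> holds
  for all scalars at once, and so there is still a new point, no matter how \<open>d k\<close> was chosen.
\<close>

lemma independent_system_exists:
  assumes basis: "\<And>U. zero_nbhd U \<Longrightarrow> \<exists>W\<in>\<B>. zero_nbhd W \<and> W \<subseteq> U"
    and unbounded: "\<And>Q. zero_nbhd Q \<Longrightarrow>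
      \<exists>U. zero_nbhd U \<and> (\<forall>E. finite E \<longrightarrow> \<not> {x. \<forall>e\<in>E. e * x \<in> Q} \<subseteq> U)"
  shows "\<exists>W V d a. independent_system n \<B> k W V d a"
proof (induction k)
  case 0
  then show ?case unfolding independent_system_def by simp
next
  case (Suc k)
  then obtain W V d a where sys: "independent_system n \<B> k W V d a" by blast
  define Q where "Q = {x. \<forall>i\<in>{..<k}. x \<in> V i}"
  have Q: "zero_nbhd Q"
    unfolding Q_def by (rule zero_nbhd_INT) (auto intro: independent_systemD(2)[OF sys])
  obtain U where U: "zero_nbhd U"
    "\<And>E. finite E \<Longrightarrow> \<not> {x. \<forall>e\<in>E. e * x \<in> Q} \<subseteq> U"
    using unbounded[OF Q] by blast
  obtain D where D: "zero_nbhd D" "\<And>x y. x \<in> D \<Longrightarrow> y \<in> D \<Longrightarrow> x - y \<in> U"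
    using zero_nbhd_diff[OF U(1)] by blast
  obtain W' where W': "W' \<in> \<B>" "zero_nbhd W'" "W' \<subseteq> D"
    using basis[OF D(1)] by blast
  obtain V' where V': "zero_nbhd V'"
    "\<forall>S f. S \<subseteq> {..<n} \<longrightarrow> (\<forall>j\<in>S. f j \<in> V') \<longrightarrow> sum f S \<in> W'"
    using zero_nbhd_sum[OF finite_lessThan W'(2)] by blast
  have "zero_nbhd {x. \<forall>j\<in>{..<k}. x \<in> {x. a j * x \<in> V'}}"
    by (rule zero_nbhd_INT) (auto intro: zero_nbhd_preimage_mult V'(1))
  then obtain d' where "d' \<in> {x. \<forall>j\<in>{..<k}. x \<in> {x. a j * x \<in> V'}}" "d' \<noteq> 0"
    using zero_nbhd_nontrivial by blast
  then have d': "d' \<noteq> 0" "\<And>j. j < k \<Longrightarrow> d' * a j \<in> V'"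
    by (simp_all add: mult.commute)
  (* The new point is x / d': multiplied by d' it lies outside U, multiplied by d i inside Q. *)
  obtain x where x: "x \<notin> U" "\<And>i. i < k \<Longrightarrow> d i / d' * x \<in> Q"
    using U(2)[of "(\<lambda>i. d i / d') ` {..<k}"] by auto
  have new: "d i * (x / d') \<in> V i" if "i < k" for i
    using x(2)[OF that] that by (simp add: Q_def)
  have apart: "d' * (x / d') \<noteq> y - z" if "y \<in> W'" "z \<in> W'" for y z
    using x(1) D(2) W'(3) that d'(1) by auto
  have "independent_system n \<B> (Suc k) (W(k := W')) (V(k := V')) (d(k := d')) (a(k := x / d'))"
    unfolding independent_system_def
  proof (intro allI impI)
    fix i assume "i < Suc k"
    then consider "i < k" | "i = k" by linarith
    then show "(W(k := W')) i \<in> \<B> \<and> zero_nbhd ((V(k := V')) i) \<and>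
       (\<forall>S f. S \<subseteq> {..<n} \<longrightarrow> (\<forall>j\<in>S. f j \<in> (V(k := V')) i) \<longrightarrow> sum f S \<in> (W(k := W')) i) \<and>
       (\<forall>y\<in>(W(k := W')) i. \<forall>z\<in>(W(k := W')) i.
          (d(k := d')) i * (a(k := x / d')) i \<noteq> y - z) \<and>
       (\<forall>j<Suc k. j \<noteq> i \<longrightarrow> (d(k := d')) i * (a(k := x / d')) j \<in> (V(k := V')) i)"
    proof cases
      case 1
      note old = independent_systemD[OF sys 1]
      have "\<forall>j<Suc k. j \<noteq> i \<longrightarrow> d i * (a(k := x / d')) j \<in> V i"
        using old(5) new[OF 1] by (auto simp: less_Suc_eq)
      then show ?thesis using old(1-4) 1 by simp
    next
      case 2
      have "\<forall>j<Suc k. j \<noteq> k \<longrightarrow> d' * (a(k := x / d')) j \<in> V'"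
        using d'(2) by (auto simp: less_Suc_eq)
      then show ?thesis using W'(1) V' apart 2 by simp
    qed
  qed
  then show ?case by blast
qed

end

section \<open>NIP and scalings of a uniformly definable family\<close>

lemma eval_tm_cong: "(\<And>i. i \<in> fv_tm t \<Longrightarrow> e i = e' i) \<Longrightarrow> eval_tm M e t = eval_tm M e' t"
proof (induction t)
  case (Fn f ts)
  then have "map (eval_tm M e) ts = map (eval_tm M e') ts" by auto
  then show ?case by (simp only: eval_tm.simps)
qed simp

lemma sat_cong: "(\<And>i. i \<in> fv_fm p \<Longrightarrow> e i = e' i) \<Longrightarrow> sat M e p \<longleftrightarrow> sat M e' p"
proof (induction p arbitrary: e e')
  case (Equal s t)
  then show ?case using eval_tm_cong[of s e e' M] eval_tm_cong[of t e e' M] by simp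
next
  case (Pred r ts)
  have "map (eval_tm M e) ts = map (eval_tm M e') ts"
    using Pred by (auto intro!: eval_tm_cong)
  then show ?case by (simp only: sat.simps)
next
  case (Neg p)
  have "sat M e p \<longleftrightarrow> sat M e' p" using Neg.prems by (intro Neg.IH) simp
  then show ?case by simp
next
  case (Conj p q)
  have "sat M e p \<longleftrightarrow> sat M e' p" using Conj.prems by (intro Conj.IH(1)) simp
  moreover have "sat M e q \<longleftrightarrow> sat M e' q" using Conj.prems by (intro Conj.IH(2)) simp
  ultimately show ?case by simp
next
  case (Ex i p)
  have "sat M (e(i := x)) p \<longleftrightarrow> sat M (e'(i := x)) p" for x
    using Ex.prems by (intro Ex.IH) auto
  then show ?case by simp
qed

lemma NIP_theory_not_has_IP:
  fixes M :: "('f, 'r, 'a) fo_struct"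
  assumes "NIP_theory TYPE('a) L (complete_theory L M)" and "wf_fm L p" and "fv_fm p \<subseteq> {..<k + l}"
  shows "\<not> has_IP M p k l"
proof -
  have "is_model M (complete_theory L M)" by (simp add: is_model_def complete_theory_def)
  then show ?thesis using assms unfolding NIP_theory_def by blast
qed

text \<open>
  If \<open>p(z, b, c)\<close> defines the family, with \<open>b\<close> the index and \<open>c\<close> the parameters, then
  \<open>\<exists>z. z = d x \<and> p(z, b, c)\<close> defines its scalings. Reusing the variable \<open>0\<close> of \<open>p\<close> as the bound
  variable \<open>z\<close> makes it unnecessary to rename variables in \<open>p\<close>; the first entry of the tuple
  \<open>(0, b, c, d)\<close> that indexes a scaling is then only a place holder.
\<close>

lemma NIP_bounds_shattered_scalings:
  fixes M :: "('f, 'r, 'a::field) fo_struct"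
  assumes "expands_field L M"
    and "NIP_theory TYPE('a) L (complete_theory L M)"
    and "uniformly_definable_family L M \<B>"
  shows "\<exists>n::nat. \<not> (\<exists>W d. (\<forall>i<n. W i \<in> \<B>) \<and>
    (\<forall>S\<subseteq>{..<n}. \<exists>x. \<forall>i<n. d i * x \<in> W i \<longleftrightarrow> i \<in> S))"
proof (rule ccontr)
  assume "\<not> ?thesis"
  then have shatter: "\<exists>W d. (\<forall>i<n. W i \<in> \<B>) \<and>
    (\<forall>S\<subseteq>{..<n}. \<exists>x. \<forall>i<n. d i * x \<in> W i \<longleftrightarrow> i \<in> S)" for n :: nat
    by blast
  obtain mul where mul: "fun_arity L mul = 2" "\<And>x y. fun_interp M mul [x, y] = x * y"
    using assms(1) unfolding expands_field_def by blast
  obtain m Y Z where Y: "definable L M m Y" and Z: "definable L M (Suc m) Z"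
    and \<B>: "\<B> = (\<lambda>b. {x. x # b \<in> Z}) ` Y"
    using assms(3) unfolding uniformly_definable_family_def by blast
  have len: "length b = m" if "b \<in> Y" for b
    using Y that unfolding definable_def by auto
  obtain p c where p: "wf_fm L p" "fv_fm p \<subseteq> {..<Suc m + length c}"
    "Z = {xs. length xs = Suc m \<and> holds M p (xs @ c)}"
    using Z unfolding definable_def by blast
  define u where "u = Suc (m + length c)"
  define q where "q = Ex 0 (Conj (Equal (Var 0) (Fn mul [Var u, Var (Suc u)])) p)"
  have q: "wf_fm L q" "fv_fm q \<subseteq> {..<Suc u + 1}"
    using p(1,2) mul(1) by (auto simp: q_def u_def)
  have holds_q: "holds M q ((0 # b @ c @ [d]) @ [x]) \<longleftrightarrow> d * x \<in> {x. x # b \<in> Z}"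
    if "length b = m" for b d x
  proof -
    let ?e = "\<lambda>i. ((0 # b @ c @ [d]) @ [x]) ! i"
    have e: "?e u = d" "?e (Suc u) = x"
      using that by (simp_all add: u_def nth_append)
    have "u \<noteq> 0" by (simp add: u_def)
    then have "holds M q ((0 # b @ c @ [d]) @ [x]) \<longleftrightarrow> sat M (?e(0 := d * x)) p"
      unfolding holds_def q_def using e mul(2) by simp
    also have "\<dots> \<longleftrightarrow> sat M (\<lambda>i. (((d * x) # b) @ c) ! i) p"
    proof (rule sat_cong)
      fix i assume "i \<in> fv_fm p"
      then have "i < Suc m + length c" using p(2) by auto
      then show "(?e(0 := d * x)) i = (((d * x) # b) @ c) ! i"
        using that by (cases i) (auto simp: nth_append)
    qed
    also have "\<dots> \<longleftrightarrow> d * x \<in> {x. x # b \<in> Z}"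
      using that by (simp add: p(3) holds_def)
    finally show ?thesis .
  qed
  have "has_IP M q (Suc u) 1"
    unfolding has_IP_def
  proof
    fix n :: nat
    obtain W d where W: "\<forall>i<n. W i \<in> \<B>"
      and sh: "\<And>S. S \<subseteq> {..<n} \<Longrightarrow> \<exists>x. \<forall>i<n. d i * x \<in> W i \<longleftrightarrow> i \<in> S"
      using shatter[of n] by blast
    have "\<forall>i<n. \<exists>b\<in>Y. W i = {x. x # b \<in> Z}" using W \<B> by blast
    then obtain b where b: "\<And>i. i < n \<Longrightarrow> b i \<in> Y" "\<And>i. i < n \<Longrightarrow> W i = {x. x # b i \<in> Z}"
      by metis
    define a where "a i = 0 # b i @ c @ [d i]" for i
    have "length (a i) = Suc u" if "i < n" for i
      using len[OF b(1)[OF that]] by (simp add: a_def u_def)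
    moreover have "\<exists>y. length y = 1 \<and> (\<forall>i<n. holds M q (a i @ y) \<longleftrightarrow> i \<in> S)"
      if S: "S \<subseteq> {..<n}" for S
    proof -
      obtain x where x: "\<forall>i<n. d i * x \<in> W i \<longleftrightarrow> i \<in> S" using sh[OF S] by blast
      have "\<forall>i<n. holds M q (a i @ [x]) \<longleftrightarrow> i \<in> S"
        using x b(2) holds_q[OF len[OF b(1)]] by (simp only: a_def) blast
      then show ?thesis by (intro exI[of _ "[x]"]) simp
    qed
    ultimately show "\<exists>a. (\<forall>i<n. length (a i) = Suc u) \<and>
      (\<forall>S\<subseteq>{..<n}. \<exists>b. length b = 1 \<and> (\<forall>i<n. holds M q (a i @ b) \<longleftrightarrow> i \<in> S))"
      by blast
  qed
  then show False using NIP_theory_not_has_IP[OF assms(2) q] by blast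
qed

section \<open>Local boundedness\<close>

theorem theorem3p4:
  fixes L :: "('f, 'r) lang"
    and K :: "('f, 'r, 'a::field) fo_struct"
    and \<tau> :: "'a topology"
  assumes "expands_field L K"
    and "NIP_theory TYPE('a) L (complete_theory L K)"
    and "ring_topology \<tau>"
    and "definable_topology L K \<tau>"
  shows "locally_bounded \<tau>"
proof (rule ccontr)
  assume not_lb: "\<not> locally_bounded \<tau>"
  interpret ring_top \<tau> by unfold_locales (rule assms(3))
  obtain \<B> where fam: "uniformly_definable_family L K \<B>"
    and base: "openin \<tau> = arbitrary union_of (\<lambda>B. B \<in> \<B>)"
    using assms(4) unfolding definable_topology_def by blast
  have basis: "\<exists>W\<in>\<B>. zero_nbhd W \<and> W \<subseteq> U" if "zero_nbhd U" for U
    using that base[unfolded openin_topology_base_unique] unfolding zero_nbhd_def by blast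
  have unbounded: "\<exists>U. zero_nbhd U \<and> (\<forall>E. finite E \<longrightarrow> \<not> {x. \<forall>e\<in>E. e * x \<in> Q} \<subseteq> U)"
    if "zero_nbhd Q" for Q
    using locally_bounded_if_scalings_subbase[OF that] not_lb by blast
  obtain n :: nat where n: "\<not> (\<exists>W d. (\<forall>i<n. W i \<in> \<B>) \<and>
    (\<forall>S\<subseteq>{..<n}. \<exists>x. \<forall>i<n. d i * x \<in> W i \<longleftrightarrow> i \<in> S))"
    using NIP_bounds_shattered_scalings[OF assms(1,2) fam] by blast
  obtain W V d a where sys: "independent_system n \<B> n W V d a"
    using independent_system_exists[OF basis unbounded] by blast
  show False
  proof (rule notE[OF n], intro exI[of _ W] exI[of _ d] conjI allI impI)
    show "W i \<in> \<B>" if "i < n" for i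
      using independent_systemD(1)[OF sys that] .
    show "\<exists>x. \<forall>i<n. d i * x \<in> W i \<longleftrightarrow> i \<in> S" for S
      using subset_sums_shatter[OF sys] by blast
  qed
qed

end
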